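(* Let $F$ be a (plane) forest of size $n$. Then $$\sum_{(F,w)\in B_n(F)}q^{\mathrm{rmaj}(F,w)}=\frac{n!}{\prod_{u\in F}h_u}\prod_{u\in F}[2h_u].$$
   Context: Notation: $[1,n]=\{1,\dots,n\}$, and for a nonnegative integer $m$, $[m]=1+q+\cdots+q^{m-1}$. A forest $F$ is a (plane) rooted forest with vertex set $V(F)$; being plane, its vertices are regarded as distinguishable (implicitly labeled). Its size is the number of vertices. The hook length $h_u$ of a vertex $u$ is the number of vertices of the subtree rooted at $u$ (including $u$). A signed labeling of a forest $F$ of size $n$ is a map $w:V(F)\to\{\pm1,\dots,\pm n\}$ such that $u\mapsto|w(u)|$ is a bijection from $V(F)$ to $[1,n]$. $B_n(F)$ denotes the set of all signed labeled forests $(F,w)$ with underlying forest $F$, i.e. the set of all signed labelings of $F$. Labels are compared in the natural order of the integers. For $(F,w)\in B_n(F)$ define - $\mathrm{Des}(F,w)=\{u\in F: w(u)>w(v),\ v\text{ is the parent of }u\}$ (roots are never in this set); - $\mathrm{Des}_B(F,w)=\mathrm{Des}(F,w)\cup\{u\in F: u\text{ is a root of }F\text{ with }w(u)>0\}$; - $\mathrm{maj}_B(F,w)=\sum_{u\in\mathrm{Des}_B(F,w)}h_u$; - $\mathrm{p}(F,w)=$ the number of positive labels of $w$; - $\mathrm{rmaj}(F,w)=2\,\mathrm{maj}_B(F,w)-\mathrm{p}(F,w)$. *)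

theory Defs
  imports Complex_Main "HOL-Library.FuncSet" "HOL-Library.Sublist"
begin

(* A plane tree is given by the ordered list of the subtrees hanging from its root. *)

datatype plane_tree = Node (subtrees: "plane_tree list")

type_synonym plane_forest = "plane_tree list"

(* To make the vertices of a plane forest distinguishable, each vertex is identified with its
   address: [i] is the root of the i-th tree, and u @ [j] is the j-th child of the vertex u
   (counting from 0). Thus [] is not a vertex. *)

fun is_vertex :: "plane_forest \<Rightarrow> nat list \<Rightarrow> bool" where
  "is_vertex F [] \<longleftrightarrow> False"
| "is_vertex F [i] \<longleftrightarrow> i < length F"
| "is_vertex F (i # j # u) \<longleftrightarrow> i < length F \<and> is_vertex (subtrees (F ! i)) (j # u)"

definition vertices :: "plane_forest \<Rightarrow> nat list set" where
  "vertices F = {u. is_vertex F u}"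

definition forest_size :: "plane_forest \<Rightarrow> nat" where
  "forest_size F = card (vertices F)"

definition is_root :: "plane_forest \<Rightarrow> nat list \<Rightarrow> bool" where
  "is_root F u \<longleftrightarrow> u \<in> vertices F \<and> length u = 1"

definition is_parent :: "plane_forest \<Rightarrow> nat list \<Rightarrow> nat list \<Rightarrow> bool" where
  "is_parent F v u \<longleftrightarrow> v \<in> vertices F \<and> u \<in> vertices F \<and> (\<exists>j. u = v @ [j])"

(* The vertices of the subtree rooted at u are those whose address has u as a prefix. *)

definition hook_length :: "plane_forest \<Rightarrow> nat list \<Rightarrow> nat" where
  "hook_length F u = card {v \<in> vertices F. prefix u v}"

(* Labelings are extensional functions, i.e. they take the value undefined outside the vertex
   set, so that each labeling of the vertices is counted exactly once. *)

definition signed_labelings :: "plane_forest \<Rightarrow> (nat list \<Rightarrow> int) set" where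
  "signed_labelings F =
     {w \<in> vertices F \<rightarrow>\<^sub>E ({- int (forest_size F)..int (forest_size F)} - {0}).
        bij_betw (\<lambda>u. \<bar>w u\<bar>) (vertices F) {1..int (forest_size F)}}"

definition Des :: "plane_forest \<Rightarrow> (nat list \<Rightarrow> int) \<Rightarrow> nat list set" where
  "Des F w = {u \<in> vertices F. \<exists>v. is_parent F v u \<and> w u > w v}"

definition Des_B :: "plane_forest \<Rightarrow> (nat list \<Rightarrow> int) \<Rightarrow> nat list set" where
  "Des_B F w = Des F w \<union> {u \<in> vertices F. is_root F u \<and> w u > 0}"

definition maj_B :: "plane_forest \<Rightarrow> (nat list \<Rightarrow> int) \<Rightarrow> nat" where
  "maj_B F w = (\<Sum>u\<in>Des_B F w. hook_length F u)"

definition pos_labels :: "plane_forest \<Rightarrow> (nat list \<Rightarrow> int) \<Rightarrow> nat" where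
  "pos_labels F w = card {u \<in> vertices F. w u > 0}"

(* Integer-valued, to avoid truncated subtraction. *)

definition rmaj :: "plane_forest \<Rightarrow> (nat list \<Rightarrow> int) \<Rightarrow> int" where
  "rmaj F w = 2 * int (maj_B F w) - int (pos_labels F w)"

definition q_number :: "'a::comm_semiring_1 \<Rightarrow> nat \<Rightarrow> 'a" where
  "q_number q m = (\<Sum>i<m. q ^ i)"

(* The sums and cardinalities above range over finite sets. *)

lemma finite_vertices: "finite (vertices F)"
proof -
  have fin: "finite {u. is_vertex F u \<and> length u \<le> k}" for k F
  proof (induction k arbitrary: F)
    case 0
    have "{u. is_vertex F u \<and> length u \<le> 0} = {}"
      by auto
    then show ?case by simp
  next
    case (Suc k)
    have "{u. is_vertex F u \<and> length u \<le> Suc k} \<subseteq>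
      (\<Union>i<length F. insert [i] ((#) i ` {u. is_vertex (subtrees (F ! i)) u \<and> length u \<le> k}))"
    proof
      fix u assume "u \<in> {u. is_vertex F u \<and> length u \<le> Suc k}"
      then show "u \<in> (\<Union>i<length F.
          insert [i] ((#) i ` {u. is_vertex (subtrees (F ! i)) u \<and> length u \<le> k}))"
        by (cases "(F, u)" rule: is_vertex.cases) (auto simp: image_iff)
    qed
    then show ?case
      using Suc.IH by (auto intro: finite_subset)
  qed
  have bound: "is_vertex F u \<Longrightarrow> length u \<le> size_list size F" for F u
  proof (induction F u rule: is_vertex.induct)
    case (2 F i)
    then have "size (F ! i) \<le> size_list size F"
      by (intro size_list_estimation'[of "F ! i"]) auto
    moreover have "0 < size (F ! i)"
      by (cases "F ! i") auto
    ultimately show ?case by simp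
  next
    case (3 F i j u)
    then have "size (F ! i) \<le> size_list size F"
      by (intro size_list_estimation'[of "F ! i"]) auto
    moreover have "Suc (size_list size (subtrees (F ! i))) = size (F ! i)"
      by (cases "F ! i") auto
    ultimately show ?case using 3 by simp
  qed auto
  have "vertices F = {u. is_vertex F u \<and> length u \<le> size_list size F}"
    using bound by (auto simp: vertices_def)
  then show ?thesis using fin by simp
qed

end

theory Submission
  imports Defs
begin

text \<open>
  Give all roots of the forest a common virtual parent carrying a fixed label \<open>t\<close>. The
  descents at roots then become ordinary descents, and \<open>maj_B\<close> is the case \<open>t = 0\<close> of a statistic
  \<open>threshold_maj F t\<close> in which a root counts when its label exceeds \<open>t\<close>. This statistic makes sense
  for labelings by the elements of any finite linearly ordered set \<open>S\<close> with \<open>n\<close> elements, and the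
  theorem rests on how its distribution depends on \<open>S\<close> and \<open>t\<close>:
  if exactly \<open>k\<close> elements of \<open>S\<close> exceed \<open>t\<close>, then the labelings by \<open>S\<close> satisfy
  \<open>\<Sum> q^(threshold_maj F t w) = q^k * n! / (\<Prod> h) * (\<Prod> [h])\<close>.

  This is proved by structural induction (\<open>sum_excess_bijections\<close>). When a forest is cut into its
  first tree and the remaining trees, \<open>S\<close> is distributed over the two parts; the powers of \<open>q\<close> for
  the two parts multiply to \<open>q^k\<close> whatever the distribution, so the sum over all distributions is
  just a binomial coefficient, which combines with the two factorials.
  When a tree with \<open>h\<close> vertices loses its root, the label \<open>s\<close> of the root becomes the virtual label
  for the remaining forest. If \<open>s\<close> has \<open>i\<close> larger elements in \<open>S\<close>, the induction hypothesis
  contributes \<open>q^i\<close>, and the root itself contributes \<open>q^h\<close> precisely when \<open>i < k\<close>. As \<open>i\<close> runs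
  through \<open>0, \<dots>, h - 1\<close>, the exponents \<open>i\<close> (for \<open>i \<ge> k\<close>) and \<open>h + i\<close> (for \<open>i < k\<close>) run through
  \<open>k, \<dots>, k + h - 1\<close>, with sum \<open>q^k * [h]\<close> (\<open>sum_root_labels\<close>).

  A signed labeling is a labeling by a set \<open>S\<close> containing exactly one of \<open>i\<close> and \<open>-i\<close> for each
  \<open>1 \<le> i \<le> n\<close>, and \<open>S\<close> is determined by the set \<open>P\<close> of its positive elements. For such \<open>S\<close> and
  \<open>t = 0\<close> we have \<open>k = card P = p(F, w)\<close>, so with \<open>q\<close> replaced by its square the labelings with
  given \<open>P\<close> contribute \<open>q^(2 * card P - card P) = q^(card P)\<close> times a factor free of \<open>P\<close>. Summing
  over all \<open>P\<close> gives \<open>(1 + q)^n\<close>, and each of the \<open>n\<close> vertices absorbs one factor \<open>1 + q\<close>, because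
  \<open>[2 * h]\<close> at \<open>q\<close> is \<open>1 + q\<close> times \<open>[h]\<close> at the square of \<open>q\<close>.

  To include \<open>q = 0\<close>, where \<open>q^k\<close> cannot be cancelled, the induction is carried out for the excess
  \<open>threshold_maj F t w - k\<close>, which is nonnegative by \<open>exceeding_labels_le_threshold_maj\<close>.
\<close>

section \<open>Vertices and hook lengths of composite forests\<close>

text \<open>
  Every forest arises from the empty one by grafting a new root and by putting a tree to the left.
  A tree is the same thing as a one-tree forest, so a single predicate on forests suffices.
\<close>

lemma plane_forest_induct [case_names empty tree Cons]:
  assumes "P []"
    and tree: "\<And>G. P G \<Longrightarrow> P [Node G]"
    and Cons: "\<And>T F. P [T] \<Longrightarrow> P F \<Longrightarrow> P (T # F)"
  shows "P F"
proof -
  have forest: "P F" if "\<And>T. T \<in> set F \<Longrightarrow> P [T]" for F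
    using that by (induction F) (auto intro: assms)
  have "P [T]" for T
    by (induction T) (auto intro: tree forest)
  then show ?thesis by (rule forest)
qed

text \<open>
  The address of a vertex of \<open>F\<close> inside \<open>T # F\<close>. Together with prefixing \<open>0\<close>, which embeds \<open>G\<close> into
  \<open>[Node G]\<close>, it turns structural recursion on forests into decompositions of the vertex set.
\<close>

fun shift_right :: "nat list \<Rightarrow> nat list" where
  "shift_right [] = []"
| "shift_right (i # u) = Suc i # u"

lemma is_vertex_Cons: "is_vertex F (i # u) \<longleftrightarrow> i < length F \<and> (u = [] \<or> is_vertex (subtrees (F ! i)) u)"
  by (cases u) auto

lemma not_is_vertex_Nil [simp]: "[] \<notin> vertices F"
  by (simp add: vertices_def)

lemma vertices_Nil [simp]: "vertices [] = {}"
proof -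
  have "\<not> is_vertex [] u" for u
    by (cases u) (auto simp: is_vertex_Cons)
  then show ?thesis by (simp add: vertices_def)
qed

lemma vertices_Node: "vertices [Node G] = {[0]} \<union> (#) 0 ` vertices G"
proof -
  have "is_vertex [Node G] u \<longleftrightarrow> u = [0] \<or> (\<exists>v. u = 0 # v \<and> is_vertex G v)" for u
    by (cases u) (auto simp: is_vertex_Cons)
  then show ?thesis by (auto simp: vertices_def)
qed

lemma vertices_Cons: "vertices (T # F) = vertices [T] \<union> shift_right ` vertices F"
proof -
  have "is_vertex (T # F) u \<longleftrightarrow> is_vertex [T] u \<or> (\<exists>v. u = shift_right v \<and> is_vertex F v)" for u
  proof (cases u)
    case (Cons i v)
    show ?thesis
    proof (cases i)
      case 0
      have "0 # v \<noteq> shift_right x" for x by (cases x) auto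
      then show ?thesis using Cons 0 by (auto simp: is_vertex_Cons)
    next
      case (Suc j)
      have "Suc j # v = shift_right x \<longleftrightarrow> x = j # v" for x by (cases x) auto
      then show ?thesis using Cons Suc by (auto simp: is_vertex_Cons)
    qed
  next
    case Nil
    have "[] = shift_right v \<longleftrightarrow> v = []" for v by (cases v) auto
    then show ?thesis using Nil by auto
  qed
  then show ?thesis by (auto simp: vertices_def)
qed

lemma inj_on_shift_right [simp]: "inj_on shift_right A"
proof (rule inj_onI)
  fix u v assume "shift_right u = shift_right v"
  then show "u = v" by (cases u; cases v) auto
qed

lemma vertices_singleton_hd: "u \<in> vertices [T] \<Longrightarrow> \<exists>v. u = 0 # v"
  by (cases u) (auto simp: vertices_def is_vertex_Cons)

lemma vertices_Cons_disjoint: "vertices [T] \<inter> shift_right ` vertices F = {}"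
proof -
  have "shift_right v \<noteq> 0 # u" for u v by (cases v) auto
  then show ?thesis by (blast dest: vertices_singleton_hd)
qed

lemma prefix_shift_right: "u \<noteq> [] \<Longrightarrow> prefix (shift_right u) (shift_right v) \<longleftrightarrow> prefix u v"
  by (cases u; cases v) auto

lemma hook_length_root: "hook_length [Node G] [0] = Suc (card (vertices G))"
proof -
  have "{v \<in> vertices [Node G]. prefix [0] v} = insert [0] ((#) 0 ` vertices G)"
    by (auto simp: vertices_Node)
  then show ?thesis
    by (simp add: hook_length_def card_image finite_vertices card_insert_if image_iff)
qed

lemma hook_length_child: "v \<in> vertices G \<Longrightarrow> hook_length [Node G] (0 # v) = hook_length G v"
proof -
  assume v: "v \<in> vertices G"
  then have "v \<noteq> []" by auto
  then have "{x \<in> vertices [Node G]. prefix (0 # v) x} = (#) 0 ` {x \<in> vertices G. prefix v x}"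
    by (auto simp: vertices_Node)
  then show ?thesis by (simp add: hook_length_def card_image)
qed

lemma hook_length_first: "v \<in> vertices [T] \<Longrightarrow> hook_length (T # F) v = hook_length [T] v"
proof -
  assume v: "v \<in> vertices [T]"
  then obtain u where u: "v = 0 # u" using vertices_singleton_hd by blast
  have "\<not> prefix (0 # u) (shift_right x)" for x by (cases x) auto
  then have "{x \<in> vertices (T # F). prefix v x} = {x \<in> vertices [T]. prefix v x}"
    by (auto simp: vertices_Cons[of T F] u)
  then show ?thesis by (simp add: hook_length_def)
qed

lemma hook_length_shift_right:
  "v \<in> vertices F \<Longrightarrow> hook_length (T # F) (shift_right v) = hook_length F v"
proof -
  assume v: "v \<in> vertices F"
  then have ne: "v \<noteq> []" by auto
  have "\<not> prefix (shift_right v) x" if "x \<in> vertices [T]" for x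
    using vertices_singleton_hd[OF that] ne by (cases v) auto
  then have "{x \<in> vertices (T # F). prefix (shift_right v) x}
      = shift_right ` {x \<in> vertices F. prefix v x}"
    using ne by (auto simp: vertices_Cons[of T F] prefix_shift_right)
  then show ?thesis
    by (simp add: hook_length_def card_image)
qed

lemma card_vertices_Node: "card (vertices [Node G]) = Suc (card (vertices G))"
  by (simp add: vertices_Node card_image finite_vertices card_insert_if image_iff)

lemma card_vertices_Cons: "card (vertices (T # F)) = card (vertices [T]) + card (vertices F)"
  unfolding vertices_Cons[of T F]
  by (subst card_Un_disjoint) (simp_all add: vertices_Cons_disjoint finite_vertices card_image)

text \<open>
  The next two identities serve both the product of the hook lengths and the product of their
  \<open>q\<close>-analogues.
\<close>

lemma prod_hooks_Node:
  fixes f :: "nat \<Rightarrow> 'b::comm_monoid_mult"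
  shows "(\<Prod>u\<in>vertices [Node G]. f (hook_length [Node G] u)) =
    f (Suc (card (vertices G))) * (\<Prod>u\<in>vertices G. f (hook_length G u))"
  by (simp add: vertices_Node prod.union_disjoint finite_vertices image_iff prod.reindex
      hook_length_root hook_length_child)

lemma prod_hooks_Cons:
  fixes f :: "nat \<Rightarrow> 'b::comm_monoid_mult"
  shows "(\<Prod>u\<in>vertices (T # F). f (hook_length (T # F) u)) =
    (\<Prod>u\<in>vertices [T]. f (hook_length [T] u)) * (\<Prod>u\<in>vertices F. f (hook_length F u))"
  unfolding vertices_Cons[of T F]
  by (subst prod.union_disjoint)
    (simp_all add: vertices_Cons_disjoint finite_vertices prod.reindex hook_length_first[of _ T F]
      hook_length_shift_right)

section \<open>The major index relative to a threshold\<close>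

text \<open>
  The label of the parent of \<open>u\<close>, where \<open>t\<close> is the label of the virtual common parent of the roots.
\<close>

definition label_above :: "'l \<Rightarrow> (nat list \<Rightarrow> 'l) \<Rightarrow> nat list \<Rightarrow> 'l" where
  "label_above t w u = (if length u = 1 then t else w (butlast u))"

definition threshold_maj :: "plane_forest \<Rightarrow> 'l::linorder \<Rightarrow> (nat list \<Rightarrow> 'l) \<Rightarrow> nat" where
  "threshold_maj F t w = (\<Sum>u\<in>vertices F. if w u > label_above t w u then hook_length F u else 0)"

lemma butlast_in_vertices: "u \<in> vertices F \<Longrightarrow> length u \<noteq> 1 \<Longrightarrow> butlast u \<in> vertices F"
proof -
  have "is_vertex F u \<Longrightarrow> length u \<noteq> 1 \<Longrightarrow> is_vertex F (butlast u)" for u F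
    by (induction F u rule: is_vertex.induct) (auto simp: is_vertex_Cons)
  then show "u \<in> vertices F \<Longrightarrow> length u \<noteq> 1 \<Longrightarrow> butlast u \<in> vertices F"
    by (simp add: vertices_def)
qed

lemma threshold_maj_cong:
  assumes "\<And>u. u \<in> vertices F \<Longrightarrow> w u = w' u"
  shows "threshold_maj F t w = threshold_maj F t w'"
  unfolding threshold_maj_def
  using assms by (intro sum.cong) (auto simp: label_above_def butlast_in_vertices)

lemma threshold_maj_Nil [simp]: "threshold_maj [] t w = 0"
  by (simp add: threshold_maj_def)

text \<open>
  Deleting a root turns its label into the threshold for the forest below it.
\<close>

lemma threshold_maj_Node:
  "threshold_maj [Node G] t w =
    (if w [0] > t then Suc (card (vertices G)) else 0) + threshold_maj G (w [0]) (w \<circ> (#) 0)"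
proof -
  have la: "label_above t w (0 # v) = label_above (w [0]) (w \<circ> (#) 0) v" if "v \<in> vertices G" for v
    using that by (cases v; cases "tl v") (auto simp: label_above_def)
  have "threshold_maj [Node G] t w =
    (if w [0] > t then Suc (card (vertices G)) else 0) +
    (\<Sum>v\<in>vertices G. if w (0 # v) > label_above t w (0 # v) then hook_length [Node G] (0 # v) else 0)"
    unfolding threshold_maj_def vertices_Node
    by (subst sum.union_disjoint)
      (simp_all add: finite_vertices sum.reindex hook_length_root label_above_def image_iff)
  also have "(\<Sum>v\<in>vertices G. if w (0 # v) > label_above t w (0 # v) then hook_length [Node G] (0 # v) else 0)
     = threshold_maj G (w [0]) (w \<circ> (#) 0)"
    unfolding threshold_maj_def by (intro sum.cong) (simp_all add: la hook_length_child)
  finally show ?thesis .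
qed

lemma threshold_maj_Cons:
  "threshold_maj (T # F) t w = threshold_maj [T] t w + threshold_maj F t (w \<circ> shift_right)"
proof -
  have la: "label_above t w (shift_right v) = label_above t (w \<circ> shift_right) v" if "v \<in> vertices F" for v
    using that by (cases v; cases "tl v") (auto simp: label_above_def)
  have "(\<Sum>v\<in>vertices F. if w (shift_right v) > label_above t w (shift_right v)
          then hook_length (T # F) (shift_right v) else 0) = threshold_maj F t (w \<circ> shift_right)"
    unfolding threshold_maj_def by (intro sum.cong) (simp_all add: la hook_length_shift_right)
  moreover have "(\<Sum>v\<in>vertices [T]. if w v > label_above t w v then hook_length (T # F) v else 0)
      = threshold_maj [T] t w"
    unfolding threshold_maj_def by (intro sum.cong) (simp_all add: hook_length_first[of _ T F])
  ultimately show ?thesis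
    unfolding threshold_maj_def[of "T # F"] vertices_Cons[of T F]
    by (subst sum.union_disjoint)
      (simp_all add: finite_vertices vertices_Cons_disjoint sum.reindex)
qed

lemma maj_B_eq_threshold_maj: "maj_B F w = threshold_maj F 0 w"
proof -
  have "u \<in> Des_B F w \<longleftrightarrow> u \<in> vertices F \<and> w u > label_above 0 w u" for u
  proof (cases "u \<in> vertices F")
    case True
    then show ?thesis
    proof (cases "length u = 1")
      case True
      then have "\<not> is_parent F v u" for v by (auto simp: is_parent_def)
      then show ?thesis using True \<open>u \<in> vertices F\<close>
        by (auto simp: Des_B_def Des_def is_root_def label_above_def)
    next
      case False
      have "is_parent F v u \<longleftrightarrow> v = butlast u" for v
        using \<open>u \<in> vertices F\<close> butlast_in_vertices[OF \<open>u \<in> vertices F\<close> False]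
        by (cases u rule: rev_cases) (auto simp: is_parent_def)
      then show ?thesis using False \<open>u \<in> vertices F\<close>
        by (auto simp: Des_B_def Des_def is_root_def label_above_def)
    qed
  qed (auto simp: Des_B_def Des_def)
  then have "Des_B F w = {u \<in> vertices F. w u > label_above 0 w u}" by blast
  then show ?thesis
    by (simp add: maj_B_def threshold_maj_def sum.inter_filter[OF finite_vertices])
qed

text \<open>
  If the root label of a tree exceeds \<open>t\<close>, the root's hook length alone counts all vertices of the tree. Otherwise
  it is at most \<open>t\<close>, so the labels exceeding \<open>t\<close> lie below the root and exceed the new threshold,
  and the bound for the forest below applies.
\<close>

lemma exceeding_labels_le_threshold_maj: "card {u \<in> vertices F. t < w u} \<le> threshold_maj F t w"
proof (induction F arbitrary: t w rule: plane_forest_induct)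
  case empty
  then show ?case by simp
next
  case (tree G)
  let ?w = "w \<circ> (#) 0"
  show ?case
  proof (cases "t < w [0]")
    case True
    have "card {u \<in> vertices [Node G]. t < w u} \<le> card (vertices [Node G])"
      by (intro card_mono finite_vertices) auto
    then show ?thesis using True by (simp add: threshold_maj_Node card_vertices_Node)
  next
    case False
    then have "{u \<in> vertices [Node G]. t < w u} = (#) 0 ` {v \<in> vertices G. t < ?w v}"
      by (auto simp: vertices_Node)
    then have "card {u \<in> vertices [Node G]. t < w u} = card {v \<in> vertices G. t < ?w v}"
      by (simp add: card_image)
    also have "\<dots> \<le> card {v \<in> vertices G. w [0] < ?w v}"
      using False by (intro card_mono) (auto simp: finite_vertices)
    also have "\<dots> \<le> threshold_maj G (w [0]) ?w" by (rule tree.IH)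
    finally show ?thesis using False by (simp add: threshold_maj_Node)
  qed
next
  case (Cons T F)
  have "{u \<in> vertices (T # F). t < w u} =
    {u \<in> vertices [T]. t < w u} \<union> shift_right ` {v \<in> vertices F. t < (w \<circ> shift_right) v}"
    by (auto simp: vertices_Cons[of T F])
  then have "card {u \<in> vertices (T # F). t < w u} \<le>
      card {u \<in> vertices [T]. t < w u} + card {v \<in> vertices F. t < (w \<circ> shift_right) v}"
    by (metis (no_types, lifting) card_Un_le card_image inj_on_shift_right)
  with Cons.IH(1)[of t w] Cons.IH(2)[of t "w \<circ> shift_right"] show ?case
    by (simp add: threshold_maj_Cons[of T F] comp_def)
qed

section \<open>Labelings by a fixed set of labels\<close>

text \<open>
  Extensional functions, as in the definition of signed labelings, so that each labeling is
  represented exactly once.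
\<close>

definition bijections :: "'v set \<Rightarrow> 'l set \<Rightarrow> ('v \<Rightarrow> 'l) set" where
  "bijections V S = {w \<in> extensional V. bij_betw w V S}"

lemma card_exceeding_labels:
  assumes "w \<in> bijections V S"
  shows "card {u \<in> V. t < w u} = card {s \<in> S. t < s}"
proof -
  have "{s \<in> S. t < s} = w ` {u \<in> V. t < w u}" and "inj_on w {u \<in> V. t < w u}"
    using assms by (auto simp: bijections_def bij_betw_def inj_on_def)
  then show ?thesis by (simp add: card_image)
qed

lemma finite_bijections: "finite V \<Longrightarrow> finite S \<Longrightarrow> finite (bijections V S)"
  by (rule finite_subset[of _ "V \<rightarrow>\<^sub>E S"]) (auto simp: bijections_def PiE_iff bij_betw_def extensional_def intro!: finite_PiE)

text \<open>
  A labeling of a disjoint union amounts to a choice of the labels used on the first part, together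
  with labelings of both parts. The parts enter through embeddings \<open>\<phi>\<close> and \<open>\<psi>\<close>, so that they can be
  the vertex sets of smaller forests, whose addresses change when they are put into a larger one.
\<close>

lemma sum_bijections_Un:
  fixes \<phi> :: "'a \<Rightarrow> 'v" and \<psi> :: "'b \<Rightarrow> 'v" and S :: "'l set"
  assumes fin: "finite A" "finite B" "finite S"
    and inj: "inj_on \<phi> A" "inj_on \<psi> B" and disj: "\<phi> ` A \<inter> \<psi> ` B = {}"
  shows "(\<Sum>w\<in>bijections (\<phi> ` A \<union> \<psi> ` B) S. f (restrict (w \<circ> \<phi>) A) (restrict (w \<circ> \<psi>) B)) =
    (\<Sum>S1 | S1 \<subseteq> S \<and> card S1 = card A.
       \<Sum>w1\<in>bijections A S1. \<Sum>w2\<in>bijections B (S - S1). f w1 w2)"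
proof -
  let ?V = "\<phi> ` A \<union> \<psi> ` B"
  let ?I = "SIGMA S1 : {S1. S1 \<subseteq> S \<and> card S1 = card A}. bijections A S1 \<times> bijections B (S - S1)"
  define split where "split w = (w ` \<phi> ` A, restrict (w \<circ> \<phi>) A, restrict (w \<circ> \<psi>) B)"
    for w :: "'v \<Rightarrow> 'l"
  define glue where "glue = (\<lambda>(S1 :: 'l set, w1 :: 'a \<Rightarrow> 'l, w2 :: 'b \<Rightarrow> 'l) x.
      if x \<in> \<phi> ` A then w1 (inv_into A \<phi> x)
      else if x \<in> \<psi> ` B then w2 (inv_into B \<psi> x) else undefined)"
  have split_in: "split w \<in> ?I" if w: "w \<in> bijections ?V S" for w
  proof -
    from w have inj_w: "inj_on w ?V" and img: "w ` ?V = S"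
      by (auto simp: bijections_def bij_betw_def)
    have A: "inj_on (w \<circ> \<phi>) A" and B: "inj_on (w \<circ> \<psi>) B"
      using inj inj_w by (auto intro!: comp_inj_on intro: inj_on_subset)
    have S2: "S - w ` \<phi> ` A = w ` \<psi> ` B"
      using img inj_on_image_Int[OF inj_w, of "\<phi> ` A" "\<psi> ` B"] disj by auto
    have "card (w ` \<phi> ` A) = card A"
      using card_image[OF A] by (simp add: image_comp)
    moreover have "restrict (w \<circ> \<phi>) A \<in> bijections A (w ` \<phi> ` A)"
      using A by (simp add: bijections_def bij_betw_def image_comp)
    moreover have "restrict (w \<circ> \<psi>) B \<in> bijections B (S - w ` \<phi> ` A)"
      using B unfolding S2 by (simp add: bijections_def bij_betw_def image_comp)
    moreover have "w ` \<phi> ` A \<subseteq> S" using img by blast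
    ultimately show ?thesis unfolding split_def by blast
  qed
  have glue_A: "glue (S1, w1, w2) (\<phi> a) = w1 a" if "a \<in> A" for S1 w1 w2 a
    using that inj by (simp add: glue_def)
  have glue_B: "glue (S1, w1, w2) (\<psi> b) = w2 b" if "b \<in> B" for S1 w1 w2 b
  proof -
    have "\<psi> b \<notin> \<phi> ` A" using that disj by blast
    then show ?thesis using that inj by (simp add: glue_def)
  qed
  have glue_split: "glue (split w) = w" if w: "w \<in> bijections ?V S" for w
  proof
    fix x
    have "x \<notin> ?V \<Longrightarrow> w x = undefined"
      using w by (auto simp: bijections_def extensional_def)
    then show "glue (split w) x = w x"
      by (cases "x \<in> \<phi> ` A"; cases "x \<in> \<psi> ` B")
        (auto simp: split_def glue_A glue_B, auto simp: glue_def)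
  qed
  have split_glue: "split (glue (S1, w1, w2)) = (S1, w1, w2)"
    and glue_in: "glue (S1, w1, w2) \<in> bijections ?V S" if "(S1, w1, w2) \<in> ?I" for S1 w1 w2
  proof -
    let ?g = "glue (S1, w1, w2)"
    from that have S1: "S1 \<subseteq> S" and w1: "w1 \<in> extensional A" "bij_betw w1 A S1"
      and w2: "w2 \<in> extensional B" "bij_betw w2 B (S - S1)"
      by (auto simp: bijections_def)
    have imgA: "?g ` \<phi> ` A = S1"
      using w1 by (auto simp: image_image glue_A bij_betw_def cong: image_cong)
    have imgB: "?g ` \<psi> ` B = S - S1"
      using w2 by (auto simp: image_image glue_B bij_betw_def cong: image_cong)
    have rA: "restrict (?g \<circ> \<phi>) A = w1"
      using w1 by (intro extensionalityI[of _ A]) (auto simp: glue_A)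
    have rB: "restrict (?g \<circ> \<psi>) B = w2"
      using w2 by (intro extensionalityI[of _ B]) (auto simp: glue_B)
    show "split ?g = (S1, w1, w2)" unfolding split_def imgA rA rB ..
    have injA: "inj_on ?g (\<phi> ` A)"
      using w1 by (auto simp: inj_on_def bij_betw_def glue_A)
    have injB: "inj_on ?g (\<psi> ` B)"
      using w2 by (auto simp: inj_on_def bij_betw_def glue_B)
    have "bij_betw ?g (\<phi> ` A) S1" "bij_betw ?g (\<psi> ` B) (S - S1)"
      using imgA imgB injA injB by (simp_all add: bij_betw_def)
    then have "bij_betw ?g ?V (S1 \<union> (S - S1))"
      by (rule bij_betw_combine) auto
    moreover have "?g \<in> extensional ?V"
      by (auto simp: glue_def extensional_def)
    ultimately show "?g \<in> bijections ?V S"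
      using S1 by (simp add: bijections_def Un_absorb1)
  qed
  have "(\<Sum>w\<in>bijections ?V S. f (restrict (w \<circ> \<phi>) A) (restrict (w \<circ> \<psi>) B)) =
    (\<Sum>(S1, w1, w2)\<in>?I. f w1 w2)"
  proof (rule sum.reindex_bij_witness[of _ glue split])
    show "(case split w of (S1, w1, w2) \<Rightarrow> f w1 w2) = f (restrict (w \<circ> \<phi>) A) (restrict (w \<circ> \<psi>) B)"
      for w by (simp add: split_def)
  qed (use split_in glue_split split_glue glue_in in \<open>auto simp del: SigmaI\<close>)
  also have "\<dots> = (\<Sum>S1 | S1 \<subseteq> S \<and> card S1 = card A.
      \<Sum>(w1, w2)\<in>bijections A S1 \<times> bijections B (S - S1). f w1 w2)"
    using fin by (subst sum.Sigma)
      (auto simp: finite_bijections finite_subset intro!: finite_cartesian_product finite_bijections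
        dest: finite_subset)
  also have "\<dots> = (\<Sum>S1 | S1 \<subseteq> S \<and> card S1 = card A.
       \<Sum>w1\<in>bijections A S1. \<Sum>w2\<in>bijections B (S - S1). f w1 w2)"
    by (simp add: sum.cartesian_product)
  finally show ?thesis .
qed

lemma sum_bijections_insert:
  assumes fin: "finite B" "finite S" and inj: "inj_on \<psi> B" and "a \<notin> \<psi> ` B"
  shows "(\<Sum>w\<in>bijections (insert a (\<psi> ` B)) S. f (w a) (restrict (w \<circ> \<psi>) B)) =
    (\<Sum>s\<in>S. \<Sum>w\<in>bijections B (S - {s}). f s w)"
proof -
  have single: "bijections {a} {s} = {\<lambda>x\<in>{a}. s}" for s
    by (auto simp: bijections_def bij_betw_def extensional_def restrict_def)
  have sets: "{S1. S1 \<subseteq> S \<and> card S1 = Suc 0} = (\<lambda>s. {s}) ` S"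
    by (auto simp: card_1_singleton_iff)
  show ?thesis
    using sum_bijections_Un[of "{a}" B S id \<psi> "\<lambda>w1 w2. f (w1 a) w2"] assms
    by (simp add: sets sum.reindex single)
qed

section \<open>The sum over the label of a root\<close>

lemma greater_than_threshold_iff:
  fixes S :: "'l::linorder set"
  assumes "finite S" "s \<in> S"
  shows "card {x \<in> S. s < x} < card {x \<in> S. t < x} \<longleftrightarrow> t < s"
proof (intro iffI)
  assume "t < s"
  then have "{x \<in> S. s < x} \<subset> {x \<in> S. t < x}" using assms by (auto intro: less_trans)
  then show "card {x \<in> S. s < x} < card {x \<in> S. t < x}"
    using assms by (intro psubset_card_mono) auto
next
  assume less: "card {x \<in> S. s < x} < card {x \<in> S. t < x}"
  show "t < s"
  proof (rule ccontr)
    assume "\<not> t < s"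
    then have "{x \<in> S. t < x} \<subseteq> {x \<in> S. s < x}" by auto
    then have "card {x \<in> S. t < x} \<le> card {x \<in> S. s < x}"
      using assms by (intro card_mono) auto
    with less show False by simp
  qed
qed

text \<open>
  Counting larger elements enumerates \<open>S\<close> in decreasing order, starting from 0.
\<close>

lemma bij_betw_card_greater:
  fixes S :: "'l::linorder set"
  assumes "finite S"
  shows "bij_betw (\<lambda>s. card {x \<in> S. s < x}) S {..<card S}"
proof -
  have inj: "inj_on (\<lambda>s. card {x \<in> S. s < x}) S"
  proof (rule inj_onI)
    fix s t assume "s \<in> S" "t \<in> S" "card {x \<in> S. s < x} = card {x \<in> S. t < x}"
    then show "s = t"
      using greater_than_threshold_iff[OF assms, of s t] greater_than_threshold_iff[OF assms, of t s]
      by (metis less_irrefl neq_iff)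
  qed
  have "(\<lambda>s. card {x \<in> S. s < x}) ` S \<subseteq> {..<card S}"
  proof (rule image_subsetI)
    fix s assume "s \<in> S"
    then have "{x \<in> S. s < x} \<subset> S" by auto
    then show "card {x \<in> S. s < x} \<in> {..<card S}" using assms by (simp add: psubset_card_mono)
  qed
  moreover have "card ((\<lambda>s. card {x \<in> S. s < x}) ` S) = card {..<card S}"
    using card_image[OF inj] by simp
  ultimately have "(\<lambda>s. card {x \<in> S. s < x}) ` S = {..<card S}"
    by (intro card_subset_eq) auto
  with inj show ?thesis by (simp add: bij_betw_def)
qed

text \<open>
  The first \<open>k\<close> of the numbers \<open>0, \<dots>, h - 1\<close> are moved behind the others and everything is shifted
  down by \<open>k\<close>.
\<close>

lemma sum_rotated:
  fixes f :: "nat \<Rightarrow> 'a::comm_monoid_add"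
  assumes "k \<le> h"
  shows "(\<Sum>i<h. f ((if i < k then h else 0) + i - k)) = (\<Sum>i<h. f i)"
  by (rule sum.reindex_bij_witness[of _ "\<lambda>j. if j < h - k then j + k else j + k - h"
        "\<lambda>i. (if i < k then h else 0) + i - k"])
    (use assms in auto)

text \<open>
  A root with label \<open>s\<close> has hook length \<open>card S\<close> and counts when \<open>t < s\<close>; the labels larger than \<open>s\<close>
  are the ones that exceed the threshold for the forest below the root. The sum does not depend on
  \<open>t\<close>, because moving \<open>t\<close> merely rotates the list of exponents.
\<close>

lemma sum_root_labels:
  fixes S :: "'l::linorder set"
  assumes "finite S"
  shows "(\<Sum>s\<in>S. q ^ ((if t < s then card S else 0) + card {x \<in> S. s < x} - card {x \<in> S. t < x}))
    = q_number q (card S)"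
proof -
  let ?k = "card {x \<in> S. t < x}"
  have "?k \<le> card S" using assms by (intro card_mono) auto
  have "(\<Sum>s\<in>S. q ^ ((if t < s then card S else 0) + card {x \<in> S. s < x} - ?k)) =
    (\<Sum>s\<in>S. q ^ ((if card {x \<in> S. s < x} < ?k then card S else 0) + card {x \<in> S. s < x} - ?k))"
    by (intro sum.cong) (simp_all add: greater_than_threshold_iff[OF assms])
  also have "\<dots> = (\<Sum>i<card S. q ^ ((if i < ?k then card S else 0) + i - ?k))"
    by (rule sum.reindex_bij_betw[OF bij_betw_card_greater[OF assms]])
  also have "\<dots> = q_number q (card S)"
    unfolding q_number_def by (rule sum_rotated[OF \<open>?k \<le> card S\<close>])
  finally show ?thesis .
qed

section \<open>The distribution of the excess\<close>

text \<open>
  The distribution of the excess depends only on the forest, not on the label set or the threshold.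
  The hook lengths are kept on the left-hand side, which makes this a polynomial identity, valid in
  every commutative semiring. The set \<open>S\<close> and the threshold \<open>t\<close> must vary in the induction, since
  deleting a root with label \<open>s\<close> leaves the labels \<open>S - {s}\<close> and the threshold \<open>s\<close>.
\<close>

lemma sum_excess_bijections:
  fixes q :: "'a::comm_semiring_1" and S :: "'l::linorder set"
  assumes "finite S" "card S = card (vertices F)"
  shows "of_nat (\<Prod>u\<in>vertices F. hook_length F u) *
      (\<Sum>w\<in>bijections (vertices F) S. q ^ (threshold_maj F t w - card {s \<in> S. t < s})) =
    of_nat (fact (card (vertices F))) * (\<Prod>u\<in>vertices F. q_number q (hook_length F u))"
  using assms
proof (induction F arbitrary: S t rule: plane_forest_induct)
  case empty
  then have "S = {}" by simp
  moreover have "bijections {} {} = {\<lambda>u :: nat list. undefined :: 'l}"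
    by (auto simp: bijections_def bij_betw_def)
  ultimately show ?case by simp
next
  case (tree G)
  let ?V = "vertices G" and ?k = "card {s \<in> S. t < s}"
  let ?P = "of_nat (\<Prod>u\<in>?V. hook_length G u) :: 'a"
  let ?Q = "\<Prod>u\<in>?V. q_number q (hook_length G u)"
  \<comment> \<open>The root label \<open>s\<close> is the threshold for \<open>G\<close>, and \<open>rank s\<close> labels exceed it.\<close>
  define rank where "rank s = card {x \<in> S. s < x}" for s
  \<comment> \<open>The contribution of the root itself, whose hook length is \<open>card S\<close>.\<close>
  define bonus where "bonus s = (if t < s then card S else 0)" for s
  have h: "card S = Suc (card ?V)"
    using tree.prems by (simp add: card_vertices_Node)
  have inner: "?P * (\<Sum>w\<in>bijections ?V (S - {s}). q ^ (bonus s + threshold_maj G s w - ?k)) =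
      q ^ (bonus s + rank s - ?k) * (of_nat (fact (card ?V)) * ?Q)" if s: "s \<in> S" for s
  proof -
    have rank: "card {x \<in> S - {s}. s < x} = rank s"
      unfolding rank_def by (intro arg_cong[of _ _ card]) auto
    have k_le: "?k \<le> bonus s + rank s"
    proof (cases "t < s")
      case True
      have "?k \<le> card S" using tree.prems by (intro card_mono) auto
      then show ?thesis using True by (simp add: bonus_def)
    next
      case False
      then have "?k \<le> rank s"
        unfolding rank_def using tree.prems by (intro card_mono) auto
      then show ?thesis by simp
    qed
    have "q ^ (bonus s + threshold_maj G s w - ?k) =
        q ^ (bonus s + rank s - ?k) * q ^ (threshold_maj G s w - card {x \<in> S - {s}. s < x})"
      if w: "w \<in> bijections ?V (S - {s})" for w
    proof -
      have "rank s \<le> threshold_maj G s w"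
        using exceeding_labels_le_threshold_maj[of G s w] card_exceeding_labels[OF w, of s] rank by simp
      then have "bonus s + threshold_maj G s w - ?k = (bonus s + rank s - ?k) + (threshold_maj G s w - rank s)"
        using k_le by simp
      then show ?thesis by (simp only: rank power_add)
    qed
    then have "?P * (\<Sum>w\<in>bijections ?V (S - {s}). q ^ (bonus s + threshold_maj G s w - ?k)) =
        q ^ (bonus s + rank s - ?k) *
        (?P * (\<Sum>w\<in>bijections ?V (S - {s}). q ^ (threshold_maj G s w - card {x \<in> S - {s}. s < x})))"
      by (simp add: mult.left_commute sum_distrib_left)
    also have "?P * (\<Sum>w\<in>bijections ?V (S - {s}). q ^ (threshold_maj G s w - card {x \<in> S - {s}. s < x})) =
        of_nat (fact (card ?V)) * ?Q"
      using tree.prems s h by (intro tree.IH) auto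
    finally show ?thesis .
  qed
  have "(\<Sum>w\<in>bijections (vertices [Node G]) S. q ^ (threshold_maj [Node G] t w - ?k)) =
      (\<Sum>w\<in>bijections (insert [0] ((#) 0 ` ?V)) S.
        q ^ (bonus (w [0]) + threshold_maj G (w [0]) (restrict (w \<circ> (#) 0) ?V) - ?k))"
  proof (rule sum.cong)
    fix w :: "nat list \<Rightarrow> 'l"
    have "threshold_maj G (w [0]) (restrict (w \<circ> (#) 0) ?V) = threshold_maj G (w [0]) (w \<circ> (#) 0)"
      by (rule threshold_maj_cong) simp
    then show "q ^ (threshold_maj [Node G] t w - ?k) =
        q ^ (bonus (w [0]) + threshold_maj G (w [0]) (restrict (w \<circ> (#) 0) ?V) - ?k)"
      by (simp add: threshold_maj_Node bonus_def h)
  qed (simp add: vertices_Node)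
  also have "\<dots> = (\<Sum>s\<in>S. \<Sum>w\<in>bijections ?V (S - {s}). q ^ (bonus s + threshold_maj G s w - ?k))"
    using tree.prems by (intro sum_bijections_insert) (auto simp: finite_vertices)
  finally have "?P * (\<Sum>w\<in>bijections (vertices [Node G]) S. q ^ (threshold_maj [Node G] t w - ?k)) =
      (\<Sum>s\<in>S. q ^ (bonus s + rank s - ?k)) * (of_nat (fact (card ?V)) * ?Q)"
    by (simp only: sum_distrib_left[of ?P _ S] sum_distrib_right inner cong: sum.cong)
  also have "(\<Sum>s\<in>S. q ^ (bonus s + rank s - ?k)) = q_number q (card S)"
    unfolding bonus_def rank_def by (rule sum_root_labels[OF tree.prems(1)])
  finally have main: "?P * (\<Sum>w\<in>bijections (vertices [Node G]) S. q ^ (threshold_maj [Node G] t w - ?k)) =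
      q_number q (card S) * (of_nat (fact (card ?V)) * ?Q)" .
  have "of_nat (\<Prod>u\<in>vertices [Node G]. hook_length [Node G] u) = of_nat (card S) * ?P"
    using prod_hooks_Node[of "\<lambda>x. x" G] by (simp only: h of_nat_mult)
  moreover have "(\<Prod>u\<in>vertices [Node G]. q_number q (hook_length [Node G] u)) = q_number q (card S) * ?Q"
    using prod_hooks_Node[of "q_number q" G] by (simp add: h)
  moreover have "of_nat (fact (card (vertices [Node G]))) = (of_nat (card S) * of_nat (fact (card ?V)) :: 'a)"
    by (simp only: card_vertices_Node h fact_Suc of_nat_mult of_nat_id)
  ultimately show ?case
    using main by (simp only: mult.assoc) (simp only: mult.left_commute)
next
  case (Cons T F)
  let ?V = "vertices [T]" and ?W = "vertices F" and ?k = "\<lambda>S. card {s \<in> S. t < s}"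
  let ?P1 = "of_nat (\<Prod>u\<in>?V. hook_length [T] u) :: 'a"
  let ?P2 = "of_nat (\<Prod>u\<in>?W. hook_length F u) :: 'a"
  let ?Q1 = "\<Prod>u\<in>?V. q_number q (hook_length [T] u)"
  let ?Q2 = "\<Prod>u\<in>?W. q_number q (hook_length F u)"
  let ?e1 = "\<lambda>S1 w. q ^ (threshold_maj [T] t w - ?k S1)" and ?e2 = "\<lambda>S2 w. q ^ (threshold_maj F t w - ?k S2)"
  have card_S: "card S = card ?V + card ?W"
    using Cons.prems by (simp add: card_vertices_Cons[of T F])
  have inner: "?P1 * ?P2 * (\<Sum>w1\<in>bijections ?V S1. \<Sum>w2\<in>bijections ?W (S - S1).
        q ^ (threshold_maj [T] t w1 + threshold_maj F t w2 - ?k S)) =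
      of_nat (fact (card ?V)) * of_nat (fact (card ?W)) * (?Q1 * ?Q2)"
    if S1: "S1 \<subseteq> S" "card S1 = card ?V" for S1
  proof -
    have fin: "finite S1" "finite (S - S1)"
      using S1 Cons.prems by (auto dest: finite_subset)
    \<comment> \<open>Both parts keep the threshold \<open>t\<close>, so the numbers of labels exceeding it add up to \<open>?k S\<close>.\<close>
    have "{s \<in> S. t < s} = {s \<in> S1. t < s} \<union> {s \<in> S - S1. t < s}" using S1 by auto
    then have k: "?k S = ?k S1 + ?k (S - S1)"
      using fin by (simp add: card_Un_disjoint disjoint_iff)
    have "q ^ (threshold_maj [T] t w1 + threshold_maj F t w2 - ?k S) = ?e1 S1 w1 * ?e2 (S - S1) w2"
      if w: "w1 \<in> bijections ?V S1" "w2 \<in> bijections ?W (S - S1)" for w1 w2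
    proof -
      have "?k S1 \<le> threshold_maj [T] t w1" "?k (S - S1) \<le> threshold_maj F t w2"
        using exceeding_labels_le_threshold_maj[of "[T]" t w1] card_exceeding_labels[OF w(1), of t]
          exceeding_labels_le_threshold_maj[of F t w2] card_exceeding_labels[OF w(2), of t] by simp_all
      then show ?thesis by (simp add: k flip: power_add)
    qed
    then have "?P1 * ?P2 * (\<Sum>w1\<in>bijections ?V S1. \<Sum>w2\<in>bijections ?W (S - S1).
        q ^ (threshold_maj [T] t w1 + threshold_maj F t w2 - ?k S)) =
      (?P1 * (\<Sum>w1\<in>bijections ?V S1. ?e1 S1 w1)) * (?P2 * (\<Sum>w2\<in>bijections ?W (S - S1). ?e2 (S - S1) w2))"
      by (simp add: sum_product mult_ac)
    also have "?P1 * (\<Sum>w1\<in>bijections ?V S1. ?e1 S1 w1) = of_nat (fact (card ?V)) * ?Q1"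
      using fin S1 by (intro Cons.IH) auto
    also have "?P2 * (\<Sum>w2\<in>bijections ?W (S - S1). ?e2 (S - S1) w2) = of_nat (fact (card ?W)) * ?Q2"
      using fin S1 card_S by (intro Cons.IH) (auto simp: card_Diff_subset)
    finally show ?thesis by (simp only: mult_ac)
  qed
  have "(\<Sum>w\<in>bijections (vertices (T # F)) S. q ^ (threshold_maj (T # F) t w - ?k S)) =
      (\<Sum>w\<in>bijections (id ` ?V \<union> shift_right ` ?W) S.
        q ^ (threshold_maj [T] t (restrict (w \<circ> id) ?V) + threshold_maj F t (restrict (w \<circ> shift_right) ?W) - ?k S))"
  proof (rule sum.cong)
    fix w :: "nat list \<Rightarrow> 'l"
    have "threshold_maj [T] t (restrict (w \<circ> id) ?V) = threshold_maj [T] t w"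
      "threshold_maj F t (restrict (w \<circ> shift_right) ?W) = threshold_maj F t (w \<circ> shift_right)"
      by (rule threshold_maj_cong; simp)+
    then show "q ^ (threshold_maj (T # F) t w - ?k S) =
        q ^ (threshold_maj [T] t (restrict (w \<circ> id) ?V) + threshold_maj F t (restrict (w \<circ> shift_right) ?W) - ?k S)"
      by (simp only: threshold_maj_Cons[of T F])
  qed (simp add: vertices_Cons[of T F])
  also have "\<dots> = (\<Sum>S1 | S1 \<subseteq> S \<and> card S1 = card ?V.
      \<Sum>w1\<in>bijections ?V S1. \<Sum>w2\<in>bijections ?W (S - S1).
        q ^ (threshold_maj [T] t w1 + threshold_maj F t w2 - ?k S))"
    using Cons.prems vertices_Cons_disjoint[of T F]
    by (intro sum_bijections_Un) (auto simp: finite_vertices)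
  finally have "?P1 * ?P2 * (\<Sum>w\<in>bijections (vertices (T # F)) S.
        q ^ (threshold_maj (T # F) t w - ?k S)) =
      (\<Sum>S1 | S1 \<subseteq> S \<and> card S1 = card ?V.
        ?P1 * ?P2 * (\<Sum>w1\<in>bijections ?V S1. \<Sum>w2\<in>bijections ?W (S - S1).
          q ^ (threshold_maj [T] t w1 + threshold_maj F t w2 - ?k S)))"
    by (simp only: sum_distrib_left[of "?P1 * ?P2" _ "{S1. S1 \<subseteq> S \<and> card S1 = card ?V}"])
  also have "\<dots> = (\<Sum>S1 | S1 \<subseteq> S \<and> card S1 = card ?V.
      of_nat (fact (card ?V)) * of_nat (fact (card ?W)) * (?Q1 * ?Q2))"
    by (intro sum.cong refl inner) simp_all
  also have "\<dots> = of_nat (card S choose card ?V) *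
      (of_nat (fact (card ?V)) * of_nat (fact (card ?W)) * (?Q1 * ?Q2))"
    by (simp add: n_subsets[OF Cons.prems(1)])
  also have "\<dots> = of_nat (fact (card ?V) * fact (card ?W) * (card S choose card ?V)) * (?Q1 * ?Q2)"
    by (simp only: of_nat_mult mult_ac)
  also have "fact (card ?V) * fact (card ?W) * (card S choose card ?V) = (fact (card S) :: nat)"
    using binomial_fact_lemma[of "card ?V" "card S"] by (simp add: card_S)
  finally show ?case
    using Cons.prems(2) prod_hooks_Cons[of "\<lambda>x. x" T F] prod_hooks_Cons[of "q_number q" T F] by simp
qed

section \<open>Signed labelings\<close>

text \<open>
  The label set of a signed labeling of \<open>n\<close> vertices whose positive labels form \<open>P\<close>.
\<close>

definition signed_set :: "nat \<Rightarrow> int set \<Rightarrow> int set" where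
  "signed_set n P = P \<union> uminus ` ({1..int n} - P)"

lemma signed_set_properties:
  assumes "P \<subseteq> {1..int n}"
  shows "finite (signed_set n P)" "card (signed_set n P) = n" "{s \<in> signed_set n P. 0 < s} = P"
proof -
  have fin: "finite P" using assms by (rule finite_subset) simp
  then show "finite (signed_set n P)" by (simp add: signed_set_def)
  have "P \<inter> uminus ` ({1..int n} - P) = {}" using assms by fastforce
  then have "card (signed_set n P) = card P + (card {1..int n} - card P)"
    using fin assms by (simp add: signed_set_def card_Un_disjoint card_image card_Diff_subset)
  moreover have "card P \<le> card {1..int n}" using assms by (intro card_mono) auto
  ultimately show "card (signed_set n P) = n" by simp
  show "{s \<in> signed_set n P. 0 < s} = P" using assms by (fastforce simp: signed_set_def)
qed

lemma bij_betw_abs_signed_set: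
  assumes "P \<subseteq> {1..int n}"
  shows "bij_betw abs (signed_set n P) {1..int n}"
proof -
  have "abs ` signed_set n P = abs ` P \<union> abs ` uminus ` ({1..int n} - P)"
    by (simp add: signed_set_def image_Un)
  also have "abs ` P = id ` P" using assms by (intro image_cong) auto
  also have "abs ` uminus ` ({1..int n} - P) = id ` ({1..int n} - P)"
    unfolding image_image by (intro image_cong) auto
  finally have image: "abs ` signed_set n P = {1..int n}" using assms by auto
  then have "inj_on abs (signed_set n P)"
    by (intro eq_card_imp_inj_on) (simp_all add: signed_set_properties[OF assms])
  with image show ?thesis by (simp add: bij_betw_def)
qed

text \<open>
  Since distinct labels have distinct absolute values, exactly one of \<open>i\<close> and \<open>- i\<close> is a label for each
  \<open>i\<close> between 1 and \<open>n\<close>; it is \<open>- i\<close> as soon as \<open>i\<close> is not a label.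
\<close>

lemma signed_set_of_image:
  assumes "bij_betw (\<lambda>u. \<bar>w u\<bar>) V {1..int n}"
  shows "w ` V = signed_set n {s \<in> w ` V. 0 < s}"
proof -
  have inj: "u = v" if "u \<in> V" "v \<in> V" "\<bar>w u\<bar> = \<bar>w v\<bar>" for u v
    using assms that by (auto simp: bij_betw_def inj_on_def)
  have img: "(\<lambda>u. \<bar>w u\<bar>) ` V = {1..int n}" using assms by (simp add: bij_betw_def)
  show ?thesis
  proof (intro set_eqI iffI)
    fix s assume "s \<in> w ` V"
    then obtain u where u: "u \<in> V" "s = w u" by blast
    then have range: "\<bar>s\<bar> \<in> {1..int n}" using img by blast
    show "s \<in> signed_set n {s \<in> w ` V. 0 < s}"
    proof (cases "0 < s")
      case True
      then show ?thesis using u by (simp add: signed_set_def)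
    next
      case False
      have "- s \<notin> w ` V"
      proof
        assume "- s \<in> w ` V"
        then obtain v where v: "v \<in> V" "w v = - s" by auto
        then have "u = v" using u by (intro inj) simp_all
        then show False using u v range by simp
      qed
      then have "- s \<in> {1..int n} - {s \<in> w ` V. 0 < s}" using False range by auto
      then have "- (- s) \<in> uminus ` ({1..int n} - {s \<in> w ` V. 0 < s})" by (rule imageI)
      then show ?thesis unfolding signed_set_def minus_minus by (rule UnI2)
    qed
  next
    fix s assume "s \<in> signed_set n {s \<in> w ` V. 0 < s}"
    then consider "s \<in> w ` V" | "- s \<in> {1..int n}" "- s \<notin> w ` V"
    proof -
      assume s: "s \<in> signed_set n {s \<in> w ` V. 0 < s}"
      assume left: "s \<in> w ` V \<Longrightarrow> thesis"
        and right: "\<lbrakk>- s \<in> {1..int n}; - s \<notin> w ` V\<rbrakk> \<Longrightarrow> thesis"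
      from s consider "s \<in> w ` V" | x where "s = - x" "x \<in> {1..int n}" "x \<notin> {s \<in> w ` V. 0 < s}"
        unfolding signed_set_def by blast
      then show thesis
      proof cases
        case 1
        then show thesis by (rule left)
      next
        case 2
        then have "x \<notin> w ` V" by simp
        then show thesis using 2 by (intro right) simp_all
      qed
    qed
    then show "s \<in> w ` V"
    proof cases
      case 2
      then have "- s \<in> (\<lambda>u. \<bar>w u\<bar>) ` V" using img by blast
      then obtain u where "u \<in> V" "\<bar>w u\<bar> = - s" by auto
      then have "w u = s \<or> w u = - s" by linarith
      moreover have "w u \<in> w ` V" using \<open>u \<in> V\<close> by (rule imageI)
      ultimately show ?thesis using 2(2) by metis
    qed
  qed
qed

lemma signed_labelings_decompose:
  "signed_labelings F =
    (\<Union>P\<in>Pow {1..int (forest_size F)}. bijections (vertices F) (signed_set (forest_size F) P))"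
proof (intro set_eqI iffI)
  fix w assume "w \<in> signed_labelings F"
  then have ext: "w \<in> extensional (vertices F)"
    and bij: "bij_betw (\<lambda>u. \<bar>w u\<bar>) (vertices F) {1..int (forest_size F)}"
    by (auto simp: signed_labelings_def PiE_iff)
  let ?P = "{s \<in> w ` vertices F. 0 < s}"
  have "inj_on w (vertices F)"
    using bij by (auto simp: bij_betw_def inj_on_def)
  then have "w \<in> bijections (vertices F) (w ` vertices F)"
    using ext by (simp add: bijections_def bij_betw_def)
  then have "w \<in> bijections (vertices F) (signed_set (forest_size F) ?P)"
    using signed_set_of_image[OF bij] by simp
  moreover have "?P \<subseteq> (\<lambda>u. \<bar>w u\<bar>) ` vertices F" by force
  then have "?P \<subseteq> {1..int (forest_size F)}" using bij by (simp add: bij_betw_def)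
  ultimately show "w \<in> (\<Union>P\<in>Pow {1..int (forest_size F)}.
      bijections (vertices F) (signed_set (forest_size F) P))" by blast
next
  fix w assume "w \<in> (\<Union>P\<in>Pow {1..int (forest_size F)}.
      bijections (vertices F) (signed_set (forest_size F) P))"
  then obtain P where P: "P \<subseteq> {1..int (forest_size F)}"
    and ext: "w \<in> extensional (vertices F)"
    and bij: "bij_betw w (vertices F) (signed_set (forest_size F) P)"
    by (auto simp: bijections_def)
  have "bij_betw (\<lambda>u. \<bar>w u\<bar>) (vertices F) {1..int (forest_size F)}"
    using bij_betw_trans[OF bij bij_betw_abs_signed_set[OF P]] by (simp add: comp_def)
  moreover have "signed_set (forest_size F) P \<subseteq> {- int (forest_size F)..int (forest_size F)} - {0}"
    using P by (fastforce simp: signed_set_def)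
  then have "w \<in> vertices F \<rightarrow>\<^sub>E ({- int (forest_size F)..int (forest_size F)} - {0})"
    using ext bij unfolding PiE_iff bij_betw_def by blast
  ultimately show "w \<in> signed_labelings F" by (simp add: signed_labelings_def)
qed

text \<open>
  Splitting \<open>[2 * m]\<close> into even and odd exponents.
\<close>

lemma q_number_double: "q_number q (2 * m) = (1 + q) * q_number (q\<^sup>2) m"
proof (induction m)
  case (Suc m)
  have "q_number q (2 * Suc m) = q_number q (2 * m) + (1 + q) * (q\<^sup>2) ^ m"
    by (simp add: q_number_def algebra_simps flip: power_mult)
  then show ?case
    by (simp add: Suc.IH) (simp add: q_number_def distrib_left)
qed (simp add: q_number_def)

theorem theorem2p4:
  fixes F :: plane_forest and n :: nat and q :: "'a::field_char_0"
  assumes "forest_size F = n"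
  shows "(\<Sum>w\<in>signed_labelings F. q powi rmaj F w) =
    fact n / of_nat (\<Prod>u\<in>vertices F. hook_length F u) *
    (\<Prod>u\<in>vertices F. q_number q (2 * hook_length F u))"
proof -
  let ?V = "vertices F"
  let ?S = "signed_set n" and ?N = "{1..int n}"
  let ?H = "of_nat (\<Prod>u\<in>?V. hook_length F u) :: 'a"
  let ?Q = "\<Prod>u\<in>?V. q_number (q\<^sup>2) (hook_length F u)"
  have n: "card ?V = n" using assms by (simp add: forest_size_def)
  have "hook_length F u \<noteq> 0" if "u \<in> ?V" for u
    using that by (auto simp: hook_length_def finite_vertices card_eq_0_iff)
  then have H: "?H \<noteq> 0"
    by (simp add: finite_vertices)
  \<comment> \<open>Since \<open>maj_B\<close> is at least \<open>card P\<close>, the exponent is a natural number and \<open>q = 0\<close> is covered.\<close>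
  have rmaj: "q powi rmaj F w = q ^ card P * (q\<^sup>2) ^ (threshold_maj F 0 w - card {s \<in> ?S P. 0 < s})"
    if P: "P \<subseteq> ?N" and w: "w \<in> bijections ?V (?S P)" for P w
  proof -
    have p: "pos_labels F w = card P"
      using card_exceeding_labels[OF w, of 0] signed_set_properties(3)[OF P] by (simp add: pos_labels_def)
    then have "card P \<le> threshold_maj F 0 w"
      using exceeding_labels_le_threshold_maj[of F 0 w] by (simp add: pos_labels_def)
    then have "rmaj F w = int (card P + 2 * (threshold_maj F 0 w - card P))"
      by (simp add: rmaj_def p maj_B_eq_threshold_maj)
    then show ?thesis
      by (simp add: signed_set_properties(3)[OF P] power_add power_mult del: of_nat_add)
  qed
  have disjoint: "bijections ?V (?S P) \<inter> bijections ?V (?S P') = {}"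
    if P: "P \<subseteq> ?N" "P' \<subseteq> ?N" "P \<noteq> P'" for P P'
  proof -
    have "?S P \<noteq> ?S P'"
      using P signed_set_properties(3)[of P n] signed_set_properties(3)[of P' n] by metis
    then show ?thesis by (auto simp: bijections_def bij_betw_def)
  qed
  have "?H * (\<Sum>w\<in>signed_labelings F. q powi rmaj F w) =
      ?H * (\<Sum>P\<in>Pow ?N. \<Sum>w\<in>bijections ?V (?S P). q powi rmaj F w)"
    unfolding signed_labelings_decompose assms
    by (subst sum.UNION_disjoint)
      (auto simp: finite_bijections finite_vertices signed_set_properties disjoint)
  also have "\<dots> = (\<Sum>P\<in>Pow ?N. q ^ card P *
      (?H * (\<Sum>w\<in>bijections ?V (?S P). (q\<^sup>2) ^ (threshold_maj F 0 w - card {s \<in> ?S P. 0 < s}))))"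
    by (simp add: rmaj sum_distrib_left mult.left_commute)
  also have "\<dots> = (\<Sum>P\<in>Pow ?N. q ^ card P * (fact n * ?Q))"
    by (intro sum.cong refl) (subst sum_excess_bijections, simp_all add: signed_set_properties n)
  also have "\<dots> = (\<Sum>P\<in>Pow ?N. q ^ card P) * (fact n * ?Q)"
    by (simp only: sum_distrib_right)
  \<comment> \<open>Each of the \<open>n\<close> absolute values contributes 1 if its sign is negative and \<open>q\<close> if it is positive.\<close>
  also have "(\<Sum>P\<in>Pow ?N. q ^ card P) = (1 + q) ^ n"
    using prod_add[of ?N "\<lambda>_. q" "\<lambda>_. 1"] by (simp add: add.commute)
  also have "(1 + q) ^ n * (fact n * ?Q) = fact n * (\<Prod>u\<in>?V. q_number q (2 * hook_length F u))"
    by (simp only: q_number_double prod.distrib prod_constant n mult.left_commute)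
  finally show ?thesis
    using H by (simp add: field_simps)
qed

end
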